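(* Let $X$ and $Y$ be Tychonoff spaces and let $\varphi: C_p^*(X)\to C_p^*(Y)$ be a uniform homeomorphism such that both $\varphi$ and $\varphi^{-1}$ are bounded. Then: (i) $X$ is pseudocompact if and only if $Y$ is pseudocompact; (ii) for every infinite cardinal $\kappa$, the space $X$ is $\kappa$-pseudocompact if and only if $Y$ is $\kappa$-pseudocompact.
   Context: For a Tychonoff space $X$, $C_p^*(X)$ is the space of all bounded continuous real-valued functions on $X$ with the topology of pointwise convergence; it carries the uniform structure of pointwise convergence (as a subspace of $\mathbb R^X$). A uniform homeomorphism is a bijection that is uniformly continuous together with its inverse. A space is pseudocompact if every continuous real-valued function on it is bounded. For an infinite cardinal $\kappa$, a space $X$ is $\kappa$-pseudocompact if for every continuous map $f:X\to\mathbb R^\kappa$ the image $f(X)$ is compact. For a uniformly continuous surjection $\varphi:C_p^*(X)\to C_p^*(Y)$, $y\in Y$ and $K\subset X$ put $$a_\varphi(y,K)=\sup\{|\varphi(f)(y)-\varphi(g)(y)|: f,g\in C_p^*(X)\text{ and } |f(x)-g(x)|<1\ \ \forall x\in K\}\in[0,\infty].$$ The map $\varphi$ is called bounded if there is $m\in\mathbb N$ such that for every $y\in Y$ there is a finite set $K\subset X$ with $a_\varphi(y,K)\leq m$. Boundedness of $\varphi^{-1}:C_p^*(Y)\to C_p^*(X)$ is defined in the same way with the roles of $X$ and $Y$ exchanged. *)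

theory Defs
  imports "HOL-Analysis.Analysis"
begin

definition tychonoff_space :: "'a topology \<Rightarrow> bool" where
  "tychonoff_space X \<longleftrightarrow> completely_regular_space X \<and> Hausdorff_space X"

definition pseudocompact_space :: "'a topology \<Rightarrow> bool" where
  "pseudocompact_space X \<longleftrightarrow>
     (\<forall>f. continuous_map X euclideanreal f \<longrightarrow> bounded (f ` topspace X))"

text \<open>A cardinal is a cardinal order relation \<open>\<kappa>\<close> in the sense of \<^const>\<open>Card_order\<close>;
  the power \<open>\<real>\<^sup>\<kappa>\<close> is the topological product of copies of \<open>\<real>\<close> indexed by \<open>Field \<kappa>\<close>.\<close>

definition kappa_pseudocompact_space :: "'i rel \<Rightarrow> 'a topology \<Rightarrow> bool" where
  "kappa_pseudocompact_space \<kappa> X \<longleftrightarrow>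
     (\<forall>f. continuous_map X (product_topology (\<lambda>_. euclideanreal) (Field \<kappa>)) f \<longrightarrow>
          compactin (product_topology (\<lambda>_. euclideanreal) (Field \<kappa>)) (f ` topspace X))"

text \<open>The points of \<open>C\<^sub>p\<^sup>*(X)\<close> are functions on \<open>topspace X\<close>. Requiring them to be
  \<^const>\<open>extensional\<close> makes HOL equality coincide with equality of functions on
  \<open>topspace X\<close>.\<close>

definition Cp_star :: "'a topology \<Rightarrow> ('a \<Rightarrow> real) set" where
  "Cp_star X = {f \<in> extensional (topspace X).
     continuous_map X euclideanreal f \<and> bounded (f ` topspace X)}"

text \<open>The uniformity of pointwise convergence: the product uniformity of \<open>\<real>\<^sup>X\<close>, i.e. the
  coarsest one making all evaluations uniformly continuous, restricted to \<open>C\<^sub>p\<^sup>*(X)\<close>.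
  As in class \<^class>\<open>uniform_space\<close>, a uniformity is the filter of its entourages.\<close>

definition Cp_star_uniformity :: "'a topology \<Rightarrow> (('a \<Rightarrow> real) \<times> ('a \<Rightarrow> real)) filter" where
  "Cp_star_uniformity X =
     inf (INF x\<in>topspace X. filtercomap (\<lambda>(f, g). (f x, g x)) uniformity)
         (principal (Cp_star X \<times> Cp_star X))"

definition Cp_star_uniformly_continuous ::
    "'a topology \<Rightarrow> 'b topology \<Rightarrow> (('a \<Rightarrow> real) \<Rightarrow> ('b \<Rightarrow> real)) \<Rightarrow> bool" where
  "Cp_star_uniformly_continuous X Y \<phi> \<longleftrightarrow>
     \<phi> ` Cp_star X \<subseteq> Cp_star Y \<and>
     (LIM (f, g) Cp_star_uniformity X. (\<phi> f, \<phi> g) :> Cp_star_uniformity Y)"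

definition Cp_star_uniform_homeomorphism ::
    "'a topology \<Rightarrow> 'b topology \<Rightarrow> (('a \<Rightarrow> real) \<Rightarrow> ('b \<Rightarrow> real)) \<Rightarrow> bool" where
  "Cp_star_uniform_homeomorphism X Y \<phi> \<longleftrightarrow>
     bij_betw \<phi> (Cp_star X) (Cp_star Y) \<and>
     Cp_star_uniformly_continuous X Y \<phi> \<and>
     Cp_star_uniformly_continuous Y X (inv_into (Cp_star X) \<phi>)"

definition a_sup ::
    "'a topology \<Rightarrow> (('a \<Rightarrow> real) \<Rightarrow> ('b \<Rightarrow> real)) \<Rightarrow> 'b \<Rightarrow> 'a set \<Rightarrow> ennreal" where
  "a_sup X \<phi> y K =
     Sup {ennreal \<bar>\<phi> f y - \<phi> g y\<bar> | f g.
            f \<in> Cp_star X \<and> g \<in> Cp_star X \<and> (\<forall>x\<in>K. \<bar>f x - g x\<bar> < 1)}"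

definition Cp_star_bounded_map ::
    "'a topology \<Rightarrow> 'b topology \<Rightarrow> (('a \<Rightarrow> real) \<Rightarrow> ('b \<Rightarrow> real)) \<Rightarrow> bool" where
  "Cp_star_bounded_map X Y \<phi> \<longleftrightarrow>
     (\<exists>m::nat. \<forall>y\<in>topspace Y. \<exists>K. finite K \<and> K \<subseteq> topspace X \<and> a_sup X \<phi> y K \<le> of_nat m)"

end

theory Submission
  imports Defs
begin

text \<open>A support of \<open>y\<close> is a finite \<open>K \<subseteq> X\<close> with \<open>a\<^sub>\<phi>(y, K) \<le> m\<close>. If \<open>f\<close> and \<open>g\<close> in \<open>C\<^sub>p\<^sup>*(Y)\<close> are far apart at \<open>y\<close>, then \<open>\<phi>\<^sup>-\<^sup>1 f\<close> and \<open>\<phi>\<^sup>-\<^sup>1 g\<close> are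
  far apart at some point of a support of \<open>y\<close>, because \<open>\<phi>\<close> is Lipschitz for large distances along
  the segment joining them.

  If \<open>X\<close> is pseudocompact and \<open>Y\<close> is not, take a discrete sequence of bumps at points \<open>y\<^sub>k\<close> of \<open>Y\<close> and
  let \<open>f\<^sub>S\<close> be the sum of the bumps with index in \<open>S \<subseteq> \<nat>\<close>. At every \<open>x\<close> the value
  of \<open>\<phi>\<^sup>-\<^sup>1 f\<^sub>S\<close> depends, up to \<open>m\<close>, on finitely many elements of \<open>S\<close> only. A Baire category argument
  makes this uniform in \<open>x\<close> for all \<open>S\<close> in some cylinder of the Cantor set, which is absurd since
  changing \<open>S\<close> at a large \<open>k\<close> changes \<open>\<phi>\<^sup>-\<^sup>1 f\<^sub>S\<close> a lot somewhere on a support of \<open>y\<^sub>k\<close>.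

  For \<open>\<kappa>\<close>-pseudocompactness let \<open>z\<close> be a limit of the image of \<open>Y\<close> in \<open>\<real>\<^sup>\<kappa>\<close>. As \<open>Y\<close> is pseudocompact,
  \<open>z\<close> is a limit along points with supports of bounded size. These supports converge with respect
  to the \<open>\<kappa>\<close> many functions \<open>\<phi>\<^sup>-\<^sup>1 f\<close>, where \<open>f\<close> runs through bumps at \<open>z\<close>, and
  \<open>\<kappa>\<close>-pseudocompactness of \<open>X\<close> replaces the limits by points of \<open>X\<close>. Some point in the supports of
  these points is mapped to \<open>z\<close>, since otherwise a bump at \<open>z\<close> vanishes on all of them.\<close>

section \<open>Pseudocompactness as solvability of systems of equations\<close>

lemma openin_product_real_nbhd:
  fixes c :: "'i \<Rightarrow> real"
  assumes "openin (product_topology (\<lambda>_. euclideanreal) I) U" and "c \<in> U"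
  obtains J \<epsilon> where "finite J" "J \<subseteq> I" "\<epsilon> > 0"
    "\<And>d. d \<in> extensional I \<Longrightarrow> (\<forall>i\<in>J. \<bar>d i - c i\<bar> < \<epsilon>) \<Longrightarrow> d \<in> U"
proof -
  obtain V where V: "finite {i \<in> I. V i \<noteq> UNIV}" "\<And>i. i \<in> I \<Longrightarrow> open (V i)"
    "c \<in> Pi\<^sub>E I V" "Pi\<^sub>E I V \<subseteq> U"
    using assms(1)[unfolded openin_product_topology_alt, rule_format, OF assms(2)] by auto
  define J where "J = {i \<in> I. V i \<noteq> UNIV}"
  have "\<exists>e>0. ball (c i) e \<subseteq> V i" if "i \<in> J" for i
    using V that by (auto simp: J_def PiE_iff intro!: open_contains_ball_eq[THEN iffD1, rule_format])
  then obtain e where e: "\<And>i. i \<in> J \<Longrightarrow> e i > 0 \<and> ball (c i) (e i) \<subseteq> V i"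
    by metis
  \<comment> \<open>Inserting 1 keeps the set nonempty and the minimum positive when
    \<open>J\<close> is empty.\<close>
  define \<epsilon> where "\<epsilon> = Min (insert 1 (e ` J))"
  have fJ: "finite J" using V by (simp add: J_def)
  have pos: "\<epsilon> > 0" using fJ e by (auto simp: \<epsilon>_def)
  have le: "\<epsilon> \<le> e i" if "i \<in> J" for i using fJ that by (auto simp: \<epsilon>_def)
  show thesis
  proof (rule that[of J \<epsilon>])
    fix d assume d: "d \<in> extensional I" "\<forall>i\<in>J. \<bar>d i - c i\<bar> < \<epsilon>"
    have "d i \<in> V i" if "i \<in> I" for i
    proof (cases "i \<in> J")
      case True
      then have "d i \<in> ball (c i) (e i)" using d(2) le[OF True] by (force simp: dist_real_def)
      then show ?thesis using e[OF True] by auto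
    next
      case False then show ?thesis using that by (auto simp: J_def)
    qed
    then have "d \<in> Pi\<^sub>E I V" using d(1) by (auto simp: PiE_iff)
    then show "d \<in> U" using V(4) by auto
  qed (use fJ pos J_def in auto)
qed

text \<open>The values lie eventually in a box that is compact by Tychonoff's theorem, so the image
  filter has a cluster point \<open>c\<close>. One \<open>c\<close> serves all indices at once, as
  the limit of a convergent subnet would.\<close>

lemma cluster_values:
  fixes e :: "'i \<Rightarrow> 'y \<Rightarrow> real"
  assumes "F \<noteq> bot" and bound: "\<forall>\<^sub>F y in F. \<forall>i. \<bar>e i y\<bar> \<le> M i"
  obtains c where "\<And>J \<epsilon>. finite J \<Longrightarrow> \<epsilon> > 0 \<Longrightarrow> \<exists>\<^sub>F y in F. \<forall>i\<in>J. \<bar>e i y - c i\<bar> < \<epsilon>"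
proof -
  have "compactin (product_topology (\<lambda>_. euclidean) UNIV) (Pi\<^sub>E UNIV (\<lambda>i. {- M i..M i}))"
    unfolding compactin_PiE by simp
  then have "compact (Pi\<^sub>E UNIV (\<lambda>i. {- M i..M i}))"
    by (simp add: euclidean_product_topology)
  moreover have "filtermap (\<lambda>y i. e i y) F \<noteq> bot"
    using assms(1) by (simp add: filtermap_bot_iff)
  moreover have "\<forall>\<^sub>F x in filtermap (\<lambda>y i. e i y) F. x \<in> Pi\<^sub>E UNIV (\<lambda>i. {- M i..M i})"
    unfolding eventually_filtermap using bound by eventually_elim (auto simp: abs_le_iff minus_le_iff)
  ultimately obtain c where c: "inf (nhds c) (filtermap (\<lambda>y i. e i y) F) \<noteq> bot"
    by (auto simp: compact_filter)
  show thesis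
  proof
    fix J :: "'i set" and \<epsilon> :: real assume J: "finite J" "\<epsilon> > 0"
    have "open {d. \<forall>i\<in>J. \<bar>d i - c i\<bar> < \<epsilon>}"
    proof -
      have "{d. \<forall>i\<in>J. \<bar>d i - c i\<bar> < \<epsilon>} = (\<Inter>i\<in>J. {d. \<bar>d i - c i\<bar> < \<epsilon>})" by auto
      moreover have "open {d. \<bar>d i - c i\<bar> < \<epsilon>}" for i
        by (intro open_Collect_less continuous_intros continuous_on_product_coordinates)
      ultimately show ?thesis using J(1) by auto
    qed
    then have "\<forall>\<^sub>F d in nhds c. \<forall>i\<in>J. \<bar>d i - c i\<bar> < \<epsilon>"
      using J(2) by (auto simp: eventually_nhds)
    show "\<exists>\<^sub>F y in F. \<forall>i\<in>J. \<bar>e i y - c i\<bar> < \<epsilon>"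
    proof (rule ccontr)
      assume "\<not> ?thesis"
      then have "\<forall>\<^sub>F d in filtermap (\<lambda>y i. e i y) F. \<not> (\<forall>i\<in>J. \<bar>d i - c i\<bar> < \<epsilon>)"
        by (simp add: frequently_def eventually_filtermap)
      then have "\<forall>\<^sub>F d in inf (nhds c) (filtermap (\<lambda>y i. e i y) F). False"
        unfolding eventually_inf using \<open>\<forall>\<^sub>F d in nhds c. _ d\<close> by blast
      then show False using c by (simp add: trivial_limit_def)
    qed
  qed
qed

text \<open>Stands in for the statement that \<open>X\<close> meets every nonempty intersection of at most \<open>|I|\<close>
  zero sets of its Stone-Cech compactification.\<close>

definition solves_systems :: "'a topology \<Rightarrow> 'i set \<Rightarrow> bool" where
  "solves_systems X I \<longleftrightarrow>
     (\<forall>g c. (\<forall>i\<in>I. continuous_map X euclideanreal (g i)) \<longrightarrow>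
        (\<forall>J \<epsilon>. finite J \<longrightarrow> J \<subseteq> I \<longrightarrow> \<epsilon> > 0 \<longrightarrow> (\<exists>x\<in>topspace X. \<forall>i\<in>J. \<bar>g i x - c i\<bar> < \<epsilon>)) \<longrightarrow>
        (\<exists>x\<in>topspace X. \<forall>i\<in>I. g i x = c i))"

lemma solves_systemsD:
  fixes c :: "'i \<Rightarrow> real"
  assumes "solves_systems X I" "\<And>i. i \<in> I \<Longrightarrow> continuous_map X euclideanreal (g i)"
    "\<And>J \<epsilon>. finite J \<Longrightarrow> J \<subseteq> I \<Longrightarrow> \<epsilon> > 0 \<Longrightarrow> \<exists>x\<in>topspace X. \<forall>i\<in>J. \<bar>g i x - c i\<bar> < \<epsilon>"
  obtains x where "x \<in> topspace X" "\<And>i. i \<in> I \<Longrightarrow> g i x = c i"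
proof -
  have "\<exists>x\<in>topspace X. \<forall>i\<in>I. g i x = c i"
    by (rule assms(1)[unfolded solves_systems_def, rule_format]) (use assms(2,3) in auto)
  then show thesis using that by blast
qed

text \<open>Pulling a system back along \<open>e\<close> merely repeats equations. Solvability thus
  passes to every index set onto which \<open>I\<close> can be mapped.\<close>

lemma solves_systems_image:
  fixes e :: "'i \<Rightarrow> 'j"
  assumes "solves_systems X I"
  shows "solves_systems X (e ` I)"
  unfolding solves_systems_def
proof (intro allI impI)
  fix g and c :: "'j \<Rightarrow> real"
  assume g: "\<forall>i\<in>e ` I. continuous_map X euclideanreal (g i)"
    and ap: "\<forall>J \<epsilon>. finite J \<longrightarrow> J \<subseteq> e ` I \<longrightarrow> \<epsilon> > 0 \<longrightarrow>
      (\<exists>x\<in>topspace X. \<forall>i\<in>J. \<bar>g i x - c i\<bar> < \<epsilon>)"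
  obtain x where "x \<in> topspace X" "\<And>i. i \<in> I \<Longrightarrow> g (e i) x = c (e i)"
  proof (rule solves_systemsD[OF assms, of "\<lambda>i. g (e i)" "\<lambda>i. c (e i)"])
    fix J \<epsilon> assume "finite J" "J \<subseteq> I" "\<epsilon> > (0::real)"
    then show "\<exists>x\<in>topspace X. \<forall>i\<in>J. \<bar>g (e i) x - c (e i)\<bar> < \<epsilon>"
      using ap[rule_format, of "e ` J" \<epsilon>] by auto
  qed (use g in auto)
  then show "\<exists>x\<in>topspace X. \<forall>i\<in>e ` I. g i x = c i" by auto
qed

text \<open>If a system had no solution, the reciprocal distance from \<open>c\<close> in the
  metrizable space of real sequences would be continuous on \<open>X\<close>. Pseudocompactness
  bounds it, which keeps the distance away from 0, against approximate solvability.\<close>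

lemma pseudocompact_solves_nat:
  assumes "pseudocompact_space X"
  shows "solves_systems X (UNIV :: nat set)"
  unfolding solves_systems_def
proof (intro allI impI)
  fix g and c :: "nat \<Rightarrow> real"
  assume g: "\<forall>i\<in>UNIV. continuous_map X euclideanreal (g i)"
    and ap: "\<forall>J \<epsilon>. finite J \<longrightarrow> J \<subseteq> UNIV \<longrightarrow> \<epsilon> > 0 \<longrightarrow>
      (\<exists>x\<in>topspace X. \<forall>i\<in>J. \<bar>g i x - c i\<bar> < \<epsilon>)"
  define G where "G x = (\<lambda>i. g i x)" for x
  show "\<exists>x\<in>topspace X. \<forall>i\<in>UNIV. g i x = c i"
  proof (rule ccontr)
    assume no: "\<not> ?thesis"
    have pos: "dist (G x) c \<noteq> 0" if "x \<in> topspace X" for x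
      using no that by (auto simp: G_def)
    have "continuous_map X euclidean G"
      using g by (simp add: G_def continuous_map_componentwise_UNIV flip: euclidean_product_topology)
    moreover have "continuous_map euclidean euclideanreal (\<lambda>d. dist d c)"
      by (simp add: continuous_on_dist)
    ultimately have "continuous_map X euclideanreal ((\<lambda>d. dist d c) \<circ> G)"
      by (rule continuous_map_compose)
    then have "continuous_map X euclideanreal (\<lambda>x. dist (G x) c)"
      by (simp add: o_def)
    then have "continuous_map X euclideanreal (\<lambda>x. inverse (dist (G x) c))"
      using pos by (intro continuous_map_real_inverse) auto
    then have "bounded ((\<lambda>x. inverse (dist (G x) c)) ` topspace X)"
      using assms by (simp add: pseudocompact_space_def)
    then obtain B where B: "B > 0" "\<And>x. x \<in> topspace X \<Longrightarrow> \<bar>inverse (dist (G x) c)\<bar> \<le> B"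
      by (auto simp: bounded_pos)
    have far: "dist (G x) c \<ge> 1 / B" if "x \<in> topspace X" for x
    proof -
      have "dist (G x) c > 0" using pos[OF that] by (simp add: zero_less_dist_iff)
      then show ?thesis using B(2)[OF that] B(1) by (simp add: field_simps)
    qed
    have op: "openin (product_topology (\<lambda>_. euclideanreal) UNIV) (ball c (1 / B))"
      by (simp add: euclidean_product_topology)
    have "c \<in> ball c (1 / B)" using B by simp
    then obtain J \<epsilon> where J: "finite J" "\<epsilon> > 0"
      "\<And>d. d \<in> extensional UNIV \<Longrightarrow> (\<forall>i\<in>J. \<bar>d i - c i\<bar> < \<epsilon>) \<Longrightarrow> d \<in> ball c (1 / B)"
      using openin_product_real_nbhd[OF op] by metis
    from ap J obtain x where x: "x \<in> topspace X" "\<forall>i\<in>J. \<bar>g i x - c i\<bar> < \<epsilon>" by blast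
    then have "G x \<in> ball c (1 / B)" by (intro J(3)) (auto simp: G_def)
    then show False using far[OF x(1)] by (simp add: dist_commute)
  qed
qed

lemma pseudocompact_solves_countable:
  assumes "pseudocompact_space X" and "countable I"
  shows "solves_systems X I"
proof (cases "I = {}")
  case True
  \<comment> \<open>The empty set is no image of the naturals, but an empty system asks only for a
    point of \<open>X\<close>, supplied by the approximation hypothesis at
    \<open>J = {}\<close>.\<close>
  then show ?thesis by (auto simp: solves_systems_def dest: spec[of _ "{}"] intro: zero_less_one)
next
  case False
  then show ?thesis
    using solves_systems_image[OF pseudocompact_solves_nat[OF assms(1)], of "from_nat_into I"]
      assms(2) by (simp add: range_from_nat_into)
qed

text \<open>A compact image in a Hausdorff product is closed, and approximate solvability puts
  \<open>c\<close> in its closure.\<close>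

lemma kappa_pseudocompact_solves_Field:
  fixes \<kappa> :: "'k rel"
  assumes "kappa_pseudocompact_space \<kappa> X"
  shows "solves_systems X (Field \<kappa>)"
  unfolding solves_systems_def
proof (intro allI impI)
  fix g and c :: "'k \<Rightarrow> real"
  let ?P = "product_topology (\<lambda>_. euclideanreal) (Field \<kappa>)"
  assume g: "\<forall>i\<in>Field \<kappa>. continuous_map X euclideanreal (g i)"
    and ap: "\<forall>J \<epsilon>. finite J \<longrightarrow> J \<subseteq> Field \<kappa> \<longrightarrow> \<epsilon> > 0 \<longrightarrow>
      (\<exists>x\<in>topspace X. \<forall>i\<in>J. \<bar>g i x - c i\<bar> < \<epsilon>)"
  define G where "G x = (\<lambda>i\<in>Field \<kappa>. g i x)" for x
  have "continuous_map X ?P G"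
    using g unfolding continuous_map_componentwise by (auto simp: G_def)
  then have "compactin ?P (G ` topspace X)"
    using assms by (simp add: kappa_pseudocompact_space_def)
  then have "closedin ?P (G ` topspace X)"
    by (rule compactin_imp_closedin[rotated]) (simp add: Hausdorff_space_product_topology)
  moreover have "restrict c (Field \<kappa>) \<in> ?P closure_of (G ` topspace X)"
    unfolding in_closure_of
  proof (intro conjI allI impI)
    fix U assume U: "restrict c (Field \<kappa>) \<in> U \<and> openin ?P U"
    obtain J \<epsilon> where J: "finite J" "J \<subseteq> Field \<kappa>" "\<epsilon> > 0"
      "\<And>d. d \<in> extensional (Field \<kappa>) \<Longrightarrow> (\<forall>i\<in>J. \<bar>d i - restrict c (Field \<kappa>) i\<bar> < \<epsilon>) \<Longrightarrow> d \<in> U"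
      using openin_product_real_nbhd[OF conjunct2[OF U] conjunct1[OF U]] by metis
    from ap J obtain x where x: "x \<in> topspace X" "\<forall>i\<in>J. \<bar>g i x - c i\<bar> < \<epsilon>" by blast
    then have "G x \<in> U" using J(2) by (intro J(4)) (auto simp: G_def subset_iff)
    then show "\<exists>y. y \<in> G ` topspace X \<and> y \<in> U" using x by blast
  qed auto
  ultimately have "restrict c (Field \<kappa>) \<in> G ` topspace X"
    by (simp add: closure_of_closedin)
  then obtain x where x: "x \<in> topspace X" "restrict c (Field \<kappa>) = G x" by auto
  have "g i x = c i" if "i \<in> Field \<kappa>" for i
    using fun_cong[OF x(2), of i] that by (simp add: G_def)
  then show "\<exists>x\<in>topspace X. \<forall>i\<in>Field \<kappa>. g i x = c i" using x(1) by blast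
qed

text \<open>Repeat \<open>u\<close> in all coordinates; projecting the compact image to one
  coordinate \<open>k\<close> returns the range of \<open>u\<close>.\<close>

lemma kappa_pseudocompact_imp_pseudocompact:
  assumes "kappa_pseudocompact_space \<kappa> X" and "Field \<kappa> \<noteq> {}"
  shows "pseudocompact_space X"
  unfolding pseudocompact_space_def
proof (intro allI impI)
  fix u assume u: "continuous_map X euclideanreal u"
  let ?P = "product_topology (\<lambda>_. euclideanreal) (Field \<kappa>)"
  let ?G = "\<lambda>x. \<lambda>i\<in>Field \<kappa>. u x"
  obtain k where k: "k \<in> Field \<kappa>" using assms(2) by blast
  have "continuous_map X ?P ?G"
    using u unfolding continuous_map_componentwise by auto
  then have "compactin ?P (?G ` topspace X)"
    using assms by (simp add: kappa_pseudocompact_space_def)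
  then have "compactin euclideanreal ((\<lambda>d. d k) ` (?G ` topspace X))"
    by (rule image_compactin) (rule continuous_map_product_projection[OF k])
  moreover have "(\<lambda>d. d k) ` (?G ` topspace X) = u ` topspace X"
    using k by (auto simp: image_image)
  ultimately show "bounded (u ` topspace X)"
    by (simp add: compact_imp_bounded)
qed

text \<open>Pseudocompactness encloses the image in a compact box. Solvability makes it closed: a
  point of the closure is an approximately solvable system, and a solution is mapped to it.\<close>

lemma kappa_pseudocompactI:
  fixes \<kappa> :: "'k rel"
  assumes "pseudocompact_space X" and "solves_systems X (Field \<kappa>)"
  shows "kappa_pseudocompact_space \<kappa> X"
  unfolding kappa_pseudocompact_space_def
proof (intro allI impI)
  fix h
  let ?P = "product_topology (\<lambda>_. euclideanreal) (Field \<kappa>)"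
  assume h: "continuous_map X ?P h"
  have ext: "h x \<in> extensional (Field \<kappa>)" if "x \<in> topspace X" for x
    using h that by (auto simp: continuous_map_componentwise)
  have cont: "continuous_map X euclideanreal (\<lambda>x. h x i)" if "i \<in> Field \<kappa>" for i
    using h that by (auto simp: continuous_map_componentwise)
  then have "\<exists>M. \<forall>x\<in>topspace X. \<bar>h x i\<bar> \<le> M" if "i \<in> Field \<kappa>" for i
    using assms(1) that unfolding pseudocompact_space_def bounded_iff by fastforce
  then obtain M where M: "\<And>i x. i \<in> Field \<kappa> \<Longrightarrow> x \<in> topspace X \<Longrightarrow> \<bar>h x i\<bar> \<le> M i"
    by metis
  show "compactin ?P (h ` topspace X)"
  proof (rule closed_compactin)
    show "compactin ?P (Pi\<^sub>E (Field \<kappa>) (\<lambda>i. {- M i..M i}))"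
      unfolding compactin_PiE by simp
    show "h ` topspace X \<subseteq> Pi\<^sub>E (Field \<kappa>) (\<lambda>i. {- M i..M i})"
      using M ext by (force simp: PiE_iff abs_le_iff)
    have "?P closure_of (h ` topspace X) \<subseteq> h ` topspace X"
    proof
      fix z assume z: "z \<in> ?P closure_of (h ` topspace X)"
      obtain x where x: "x \<in> topspace X" "\<And>i. i \<in> Field \<kappa> \<Longrightarrow> h x i = z i"
      proof (rule solves_systemsD[OF assms(2), of "\<lambda>i x. h x i" z])
        fix J \<epsilon> assume J: "finite J" "J \<subseteq> Field \<kappa>" "\<epsilon> > (0::real)"
        define U where "U = Pi\<^sub>E (Field \<kappa>) (\<lambda>i. if i \<in> J then ball (z i) \<epsilon> else UNIV)"
        have "finite {i \<in> Field \<kappa>. (if i \<in> J then ball (z i) \<epsilon> else UNIV) \<noteq> UNIV}"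
          by (rule finite_subset[OF _ J(1)]) auto
        then have "openin ?P U"
          unfolding U_def openin_PiE_gen by auto
        moreover have "z \<in> U"
          using z J(3) by (auto simp: U_def in_closure_of PiE_iff)
        ultimately obtain x where "x \<in> topspace X" "h x \<in> U"
          using z by (auto simp: in_closure_of)
        then show "\<exists>x\<in>topspace X. \<forall>i\<in>J. \<bar>h x i - z i\<bar> < \<epsilon>"
          using J(2) by (force simp: U_def PiE_iff dist_real_def)
      qed (use cont in auto)
      moreover have "z \<in> extensional (Field \<kappa>)"
        using z by (auto simp: in_closure_of PiE_iff)
      ultimately have "z = h x" using ext[OF x(1)] by (auto intro: extensionalityI)
      then show "z \<in> h ` topspace X" using x(1) by blast
    qed
    then show "closedin ?P (h ` topspace X)"
      using continuous_map_image_subset_topspace[OF h] closure_of_subset_eq by blast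
  qed
qed

section \<open>Cardinalities of index sets\<close>

lemma card_of_finite_subsets:
  includes cardinal_syntax
  assumes "infinite A"
  shows "|{S. finite S \<and> S \<subseteq> A}| \<le>o |A|"
proof -
  \<comment> \<open>Adding one element exhibits each level as an image of \<open>A\<close> times the
    previous level; a countable union of the levels does not exceed \<open>A\<close> either.\<close>
  define Q where "Q n = {S. finite S \<and> S \<subseteq> A \<and> card S = n}" for n
  have "|Q n| \<le>o |A|" for n
  proof (induction n)
    case 0
    have "Q 0 = {{}}" by (auto simp: Q_def)
    then show ?case using assms by (simp add: card_of_singl_ordLeq infinite_imp_nonempty)
  next
    case (Suc n)
    have "Q (Suc n) \<subseteq> (\<lambda>(a, S). insert a S) ` (A \<times> Q n)"
    proof
      fix S assume S: "S \<in> Q (Suc n)"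
      then obtain a T where "S = insert a T" "a \<notin> T" "card T = n"
        by (auto simp: Q_def card_Suc_eq)
      then show "S \<in> (\<lambda>(a, S). insert a S) ` (A \<times> Q n)" using S
        by (intro image_eqI[of _ _ "(a, T)"]) (auto simp: Q_def)
    qed
    then have "|Q (Suc n)| \<le>o |A \<times> Q n|"
      by (meson card_of_image card_of_mono1 ordLeq_transitive)
    moreover have "|A \<times> Q n| \<le>o |A|"
      using assms Suc
      by (intro card_of_Times_ordLeq_infinite_Field) (auto simp: Field_card_of card_of_card_order_on card_of_mono1)
    ultimately show ?case by (rule ordLeq_transitive)
  qed
  then have "|\<Union>n\<in>UNIV. Q n| \<le>o |A|"
    using assms by (intro card_of_UNION_ordLeq_infinite) (auto simp: infinite_iff_card_of_nat)
  moreover have "(\<Union>n\<in>UNIV. Q n) = {S. finite S \<and> S \<subseteq> A}" by (auto simp: Q_def)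
  ultimately show ?thesis by simp
qed

text \<open>Prepares for functions indexed by a finite set of coordinates and a natural number:
  there are at most \<open>\<kappa>\<close> many of them.\<close>

lemma solves_systems_finite_subsets:
  fixes \<kappa> :: "'k rel"
  assumes "Cinfinite \<kappa>" and "solves_systems X (Field \<kappa>)"
  shows "solves_systems X ({S. finite S \<and> S \<subseteq> Field \<kappa>} \<times> (UNIV :: nat set))"
proof -
  include cardinal_syntax
  let ?I = "{S. finite S \<and> S \<subseteq> Field \<kappa>} \<times> (UNIV :: nat set)"
  have inf: "infinite (Field \<kappa>)" using assms(1) by (simp add: cinfinite_def)
  then have "|?I| \<le>o |Field \<kappa>|"
    using card_of_finite_subsets[OF inf]
    by (intro card_of_Times_ordLeq_infinite_Field) (auto simp: Field_card_of card_of_card_order_on infinite_iff_card_of_nat)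
  moreover have "?I \<noteq> {}" by auto
  ultimately obtain e where e: "e ` Field \<kappa> = ?I"
    using card_of_ordLeq2[of ?I "Field \<kappa>"] by auto
  show ?thesis using solves_systems_image[OF assms(2), of e] by (simp only: e)
qed

section \<open>Finite supports of bounded maps\<close>

lemma Cp_star_iff:
  "f \<in> Cp_star X \<longleftrightarrow> f \<in> extensional (topspace X) \<and> continuous_map X euclideanreal f \<and>
     (\<exists>B. \<forall>x\<in>topspace X. \<bar>f x\<bar> \<le> B)"
  by (auto simp: Cp_star_def bounded_iff)

lemma Cp_star_continuous: "f \<in> Cp_star X \<Longrightarrow> continuous_map X euclideanreal f"
  by (simp add: Cp_star_iff)

lemma restrict_in_Cp_star:
  assumes "continuous_map X euclideanreal f" and "\<And>x. x \<in> topspace X \<Longrightarrow> \<bar>f x\<bar> \<le> B"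
  shows "restrict f (topspace X) \<in> Cp_star X"
  unfolding Cp_star_iff
proof (intro conjI exI[of _ B])
  show "continuous_map X euclideanreal (restrict f (topspace X))"
    using assms(1) by (rule continuous_map_eq) simp
qed (use assms(2) in auto)

text \<open>Replaces the bound on \<open>a_sup\<close>, a supremum in \<open>ennreal\<close>, by
  inequalities between reals.\<close>

definition coarse_support ::
    "'a topology \<Rightarrow> (('a \<Rightarrow> real) \<Rightarrow> ('b \<Rightarrow> real)) \<Rightarrow> nat \<Rightarrow> 'b \<Rightarrow> 'a set \<Rightarrow> bool" where
  "coarse_support X \<phi> m y K \<longleftrightarrow> finite K \<and> K \<subseteq> topspace X \<and>
     (\<forall>f\<in>Cp_star X. \<forall>g\<in>Cp_star X. (\<forall>x\<in>K. \<bar>f x - g x\<bar> < 1) \<longrightarrow> \<bar>\<phi> f y - \<phi> g y\<bar> \<le> m)"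

lemma coarse_support_mono:
  "coarse_support X \<phi> m y K \<Longrightarrow> m \<le> m' \<Longrightarrow> coarse_support X \<phi> m' y K"
  by (force simp: coarse_support_def)

lemma Cp_star_bounded_mapE:
  assumes "Cp_star_bounded_map X Y \<phi>"
  obtains m where "\<And>y. y \<in> topspace Y \<Longrightarrow> \<exists>K. coarse_support X \<phi> m y K"
proof -
  obtain m where m: "\<And>y. y \<in> topspace Y \<Longrightarrow>
      \<exists>K. finite K \<and> K \<subseteq> topspace X \<and> a_sup X \<phi> y K \<le> of_nat m"
    using assms by (auto simp: Cp_star_bounded_map_def)
  have "\<bar>\<phi> f y - \<phi> g y\<bar> \<le> real m"
    if "a_sup X \<phi> y K \<le> of_nat m" "f \<in> Cp_star X" "g \<in> Cp_star X" "\<forall>x\<in>K. \<bar>f x - g x\<bar> < 1"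
    for f g y K
  proof -
    have "ennreal \<bar>\<phi> f y - \<phi> g y\<bar> \<le> a_sup X \<phi> y K"
      unfolding a_sup_def using that by (intro Sup_upper) blast
    also note that(1)
    finally show ?thesis by (simp add: ennreal_of_nat_eq_real_of_nat)
  qed
  then have supp: "coarse_support X \<phi> m y K"
    if "finite K" "K \<subseteq> topspace X" "a_sup X \<phi> y K \<le> of_nat m" for y K
    using that by (auto simp: coarse_support_def)
  show thesis
  proof (rule that)
    fix y assume "y \<in> topspace Y"
    then show "\<exists>K. coarse_support X \<phi> m y K" using m supp by metis
  qed
qed

text \<open>Cut the segment from \<open>f\<close> to \<open>g\<close> into \<open>L\<close> steps.
  Each moves by less than 1 on \<open>K\<close>, hence changes the value at \<open>y\<close> by at
  most \<open>m\<close>.\<close>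

lemma coarse_support_scale:
  fixes L :: nat
  assumes K: "coarse_support X \<phi> m y K" and f: "f \<in> Cp_star X" and g: "g \<in> Cp_star X"
    and "L > 0" and close: "\<And>x. x \<in> K \<Longrightarrow> \<bar>f x - g x\<bar> < real L"
  shows "\<bar>\<phi> f y - \<phi> g y\<bar> \<le> real (m * L)"
proof -
  define p where "p i = (\<lambda>x\<in>topspace X. f x + real i / real L * (g x - f x))" for i
  have p: "p i \<in> Cp_star X" for i
  proof -
    obtain A B where AB: "\<And>x. x \<in> topspace X \<Longrightarrow> \<bar>f x\<bar> \<le> A" "\<And>x. x \<in> topspace X \<Longrightarrow> \<bar>g x\<bar> \<le> B"
      using f g by (auto simp: Cp_star_iff)
    have "\<bar>f x + real i / real L * (g x - f x)\<bar> \<le> A + real i / real L * (B + A)"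
      if "x \<in> topspace X" for x
    proof -
      have "\<bar>f x + real i / real L * (g x - f x)\<bar> \<le> \<bar>f x\<bar> + \<bar>real i / real L * (g x - f x)\<bar>"
        by (rule abs_triangle_ineq)
      also have "\<bar>real i / real L * (g x - f x)\<bar> = real i / real L * \<bar>g x - f x\<bar>"
        by (simp add: abs_mult)
      also have "\<dots> \<le> real i / real L * (B + A)"
        using AB[OF that] by (intro mult_left_mono) auto
      finally show ?thesis using AB(1)[OF that] by simp
    qed
    then show ?thesis
      unfolding p_def using f g
      by (intro restrict_in_Cp_star continuous_intros) (auto simp: Cp_star_continuous)
  qed
  have "\<bar>\<phi> (p i) y - \<phi> (p (Suc i)) y\<bar> \<le> m" for i
  proof -
    have "\<bar>p i x - p (Suc i) x\<bar> < 1" if "x \<in> K" for x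
    proof -
      have "x \<in> topspace X" using K that by (auto simp: coarse_support_def)
      then have "p i x - p (Suc i) x = (f x - g x) / real L"
        using \<open>L > 0\<close> by (simp add: p_def field_simps)
      then show ?thesis using close[OF that] \<open>L > 0\<close> by simp
    qed
    then show ?thesis using K p by (auto simp: coarse_support_def)
  qed
  then have step: "\<bar>\<phi> (p 0) y - \<phi> (p i) y\<bar> \<le> real (m * i)" for i
  proof (induction i)
    case (Suc i)
    show ?case using Suc.IH[OF Suc.prems] Suc.prems[of i] by (simp add: algebra_simps)
  qed simp
  \<comment> \<open>True equalities, since \<open>f\<close> and \<open>g\<close> are
    extensional.\<close>
  have "p 0 = f" "p L = g"
    using f g \<open>L > 0\<close> by (auto simp: p_def Cp_star_iff extensional_def fun_eq_iff)
  then show ?thesis using step[of L] by simp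
qed

section \<open>Equicontinuity on the Cantor set\<close>

text \<open>Finitely many bounded functions send \<open>A\<close> into a bounded part of a finite
  power of the reals. Cut it into cubes of side \<open>\<epsilon>\<close> and choose one point of
  \<open>A\<close> for each cube that is hit.\<close>

lemma finite_net:
  fixes g :: "'i \<Rightarrow> 'x \<Rightarrow> real"
  assumes "finite I" and "\<epsilon> > 0" and bound: "\<And>i x. i \<in> I \<Longrightarrow> x \<in> A \<Longrightarrow> \<bar>g i x\<bar> \<le> M i"
  obtains R where "finite R" "R \<subseteq> A" "\<And>x. x \<in> A \<Longrightarrow> \<exists>r\<in>R. \<forall>i\<in>I. \<bar>g i x - g i r\<bar> \<le> \<epsilon>"
proof -
  define q where "q x = (\<lambda>i\<in>I. \<lfloor>g i x / \<epsilon>\<rfloor>)" for x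
  have "\<lfloor>g i x / \<epsilon>\<rfloor> \<in> {\<lfloor>- M i / \<epsilon>\<rfloor>..\<lfloor>M i / \<epsilon>\<rfloor>}" if "i \<in> I" "x \<in> A" for i x
  proof -
    have "- M i \<le> g i x" "g i x \<le> M i" using bound[OF that] by auto
    then show ?thesis
      using \<open>\<epsilon> > 0\<close> by (simp only: atLeastAtMost_iff floor_mono divide_right_mono less_imp_le)
  qed
  then have "q ` A \<subseteq> Pi\<^sub>E I (\<lambda>i. {\<lfloor>- M i / \<epsilon>\<rfloor>..\<lfloor>M i / \<epsilon>\<rfloor>})"
    by (auto simp: q_def simp del: atLeastAtMost_iff)
  then have "finite (q ` A)"
    by (rule finite_subset) (simp add: assms(1) finite_PiE)
  then obtain R where R: "R \<subseteq> A" "finite R" "q ` A = q ` R"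
    using finite_subset_image[of "q ` A" q A] by blast
  show thesis
  proof
    fix x assume "x \<in> A"
    then have "q x \<in> q ` R" using R(3) by blast
    then obtain r where r: "r \<in> R" "q x = q r" by blast
    have "\<bar>g i x - g i r\<bar> \<le> \<epsilon>" if "i \<in> I" for i
    proof -
      have "\<lfloor>g i x / \<epsilon>\<rfloor> = \<lfloor>g i r / \<epsilon>\<rfloor>"
        using fun_cong[OF r(2), of i] that by (simp add: q_def)
      then have "\<bar>g i x / \<epsilon> - g i r / \<epsilon>\<bar> < 1" by linarith
      then show ?thesis using \<open>\<epsilon> > 0\<close> by (simp add: field_simps flip: diff_divide_distrib)
    qed
    then show "\<exists>r\<in>R. \<forall>i\<in>I. \<bar>g i x - g i r\<bar> \<le> \<epsilon>" using r(1) by blast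
  qed (use R in auto)
qed

lemma Int_lessThan_mono:
  fixes S T :: "nat set"
  assumes "S \<inter> {..<N} = T \<inter> {..<N}" and "M \<le> N"
  shows "S \<inter> {..<M} = T \<inter> {..<M}"
proof -
  have "{..<M} = {..<N} \<inter> {..<M}" using assms(2) by auto
  then show ?thesis using assms(1) by (metis Int_assoc)
qed

text \<open>The Baire category theorem for the Cantor set: some \<open>E n\<close> is dense in some
  cylinder. Otherwise one shrinks cylinders successively, avoiding \<open>E n\<close> at stage
  \<open>n\<close>, and their common point lies in no \<open>E n\<close>.\<close>

lemma Baire_cylinder:
  fixes E :: "nat \<Rightarrow> nat set set"
  assumes "(\<Union>n. E n) = UNIV"
  shows "\<exists>n N S. \<forall>T M. T \<inter> {..<N} = S \<inter> {..<N} \<longrightarrow> (\<exists>T'\<in>E n. T' \<inter> {..<M} = T \<inter> {..<M})"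
proof (rule ccontr)
  assume "\<not> ?thesis"
  then have ex: "\<forall>n N S. \<exists>T M. T \<inter> {..<N} = S \<inter> {..<N} \<and> \<not> (\<exists>T'\<in>E n. T' \<inter> {..<M} = T \<inter> {..<M})"
    by (simp only: not_ex not_all not_imp simp_thms)
  \<comment> \<open>A pair \<open>(T, N)\<close> encodes the cylinder of all sets that agree with
    \<open>T\<close> below \<open>N\<close>.\<close>
  define P where "P n q q' \<longleftrightarrow> fst q' \<inter> {..<snd q} = fst q \<inter> {..<snd q} \<and> snd q < snd q' \<and>
      (\<forall>T'\<in>E n. T' \<inter> {..<snd q'} \<noteq> fst q' \<inter> {..<snd q'})"
    for n and q q' :: "nat set \<times> nat"
  have step: "\<exists>q'. P n q q'" for n q
  proof -
    obtain T M where TM: "T \<inter> {..<snd q} = fst q \<inter> {..<snd q}"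
        "\<not> (\<exists>T'\<in>E n. T' \<inter> {..<M} = T \<inter> {..<M})"
      using ex by metis
    define M' where "M' = max M (Suc (snd q))"
    have "T' \<inter> {..<M'} \<noteq> T \<inter> {..<M'}" if "T' \<in> E n" for T'
    proof
      assume "T' \<inter> {..<M'} = T \<inter> {..<M'}"
      then have "T' \<inter> {..<M} = T \<inter> {..<M}"
        by (rule Int_lessThan_mono) (simp add: M'_def)
      then show False using TM(2) that by blast
    qed
    then have "P n q (T, M')" using TM(1) by (simp add: P_def M'_def)
    then show ?thesis by blast
  qed
  obtain q where q: "\<And>n. P n (q n) (q (Suc n))"
    using dependent_nat_choice[of "\<lambda>_ _. True" P] step by auto
  define U where "U n = fst (q n)" for n
  define N where "N n = snd (q n)" for n
  have U: "U (Suc n) \<inter> {..<N n} = U n \<inter> {..<N n}" and N: "N n < N (Suc n)"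
    and avoid: "T \<in> E n \<Longrightarrow> T \<inter> {..<N (Suc n)} \<noteq> U (Suc n) \<inter> {..<N (Suc n)}" for n T
    using q[of n] by (simp_all add: P_def U_def N_def)
  have smN: "strict_mono N" using N by (simp add: strict_mono_Suc_iff)
  have agree: "U k \<inter> {..<N n} = U n \<inter> {..<N n}" if "n \<le> k" for n k
    using that
  proof (induction k rule: dec_induct)
    case (step k)
    have "N n \<le> N k" using smN step.hyps(1) by (simp add: strict_mono_less_eq)
    then have "U (Suc k) \<inter> {..<N n} = U k \<inter> {..<N n}"
      by (rule Int_lessThan_mono[OF U])
    then show ?case using step.IH by simp
  qed simp
  \<comment> \<open>Since \<open>N\<close> is strictly increasing, \<open>i < N (Suc i)\<close>, so
    membership of \<open>i\<close> is settled from stage \<open>Suc i\<close> on.\<close>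
  define S where "S = {i. i \<in> U (Suc i)}"
  have "S \<inter> {..<N n} = U n \<inter> {..<N n}" for n
  proof -
    have "i \<in> U (Suc i) \<longleftrightarrow> i \<in> U n" if "i < N n" for i :: nat
    proof (cases "n \<le> Suc i")
      case True
      then show ?thesis using agree[OF True] that by blast
    next
      case False
      have "i < N (Suc i)" using strict_mono_imp_increasing[OF smN, of "Suc i"] by simp
      then show ?thesis using agree[of "Suc i" n] False by auto
    qed
    then show ?thesis by (auto simp: S_def)
  qed
  then have "S \<notin> E n" for n using avoid by blast
  then show False using assms by blast
qed

text \<open>A coarse form of Namioka's theorem: a map on \<open>X \<times> 2\<^sup>\<omega>\<close> that is continuous in the first variable
  and, up to the error \<open>m\<close>, continuous in the second one is, up to a multiple of \<open>m\<close>,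
  equicontinuous at some point of the Cantor set, which is encoded as \<open>nat set\<close>.\<close>

lemma coarse_Namioka:
  fixes g :: "nat set \<Rightarrow> 'a \<Rightarrow> real" and m :: real
  assumes pc: "pseudocompact_space X"
    and cont: "\<And>S. continuous_map X euclideanreal (g S)"
    and loc: "\<And>x. x \<in> topspace X \<Longrightarrow>
      \<exists>N. \<forall>S T. S \<inter> {..<N} = T \<inter> {..<N} \<longrightarrow> \<bar>g S x - g T x\<bar> \<le> m"
  shows "\<exists>N S. \<forall>T T'. T \<inter> {..<N} = S \<inter> {..<N} \<longrightarrow> T' \<inter> {..<N} = S \<inter> {..<N} \<longrightarrow>
    (\<forall>x\<in>topspace X. \<bar>g T x - g T' x\<bar> \<le> 9 * m + 2)"
proof -
  have "\<exists>B. \<forall>x\<in>topspace X. \<bar>g S x\<bar> \<le> B" for S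
    using pc cont[of S] unfolding pseudocompact_space_def bounded_iff by fastforce
  then obtain B where B: "\<And>S x. x \<in> topspace X \<Longrightarrow> \<bar>g S x\<bar> \<le> B S"
    by metis
  obtain L where L: "\<And>x S T. x \<in> topspace X \<Longrightarrow> S \<inter> {..<L x} = T \<inter> {..<L x} \<Longrightarrow> \<bar>g S x - g T x\<bar> \<le> m"
    using loc by metis
  define close where "close n x x' \<longleftrightarrow> (\<forall>s\<in>Pow {..<n}. \<bar>g s x - g s x'\<bar> \<le> 1 / real (Suc n))" for n x x'
  define E where "E n = {S. \<forall>x\<in>topspace X. \<forall>x'\<in>topspace X. close n x x' \<longrightarrow>
      \<bar>g S x - g S x'\<bar> \<le> 2 * m + 1}" for n
  \<comment> \<open>Otherwise pseudocompactness produces two points of \<open>X\<close> that are not separated by any finite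
    \<open>s\<close> but are separated by \<open>S\<close> by more than \<open>2 * m\<close>, although \<open>S\<close> can be replaced by a finite
    \<open>s\<close> at both of them.\<close>
  have "\<exists>n. S \<in> E n" for S
  proof (rule ccontr)
    assume "\<not> ?thesis"
    then have "\<forall>n. \<exists>x x'. x \<in> topspace X \<and> x' \<in> topspace X \<and> close n x x' \<and>
        \<bar>g S x - g S x'\<bar> > 2 * m + 1"
      by (force simp: E_def)
    then obtain x x' where x: "\<And>n. x n \<in> topspace X" and x': "\<And>n. x' n \<in> topspace X"
      and cl: "\<And>n. close n (x n) (x' n)" and far: "\<And>n. \<bar>g S (x n) - g S (x' n)\<bar> > 2 * m + 1"
      by metis
    \<comment> \<open>One Boolean-indexed family makes both sequences cluster along the same
      indices.\<close>
    define xb where "xb b n = (if b then x n else x' n)" for b n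
    have xb: "xb b n \<in> topspace X" for b n using x x' by (simp add: xb_def)
    have "\<forall>\<^sub>F n in sequentially. \<forall>p. \<bar>case p of (b, s) \<Rightarrow> g s (xb b n)\<bar> \<le> (case p of (b, s) \<Rightarrow> B s)"
      using B xb by (auto intro!: always_eventually)
    note cluster = cluster_values[OF trivial_limit_sequentially this]
    obtain c where c: "\<And>J \<epsilon>. finite J \<Longrightarrow> \<epsilon> > 0 \<Longrightarrow>
        \<exists>\<^sub>F n in sequentially. \<forall>p\<in>J. \<bar>(case p of (b, s) \<Rightarrow> g s (xb b n)) - c p\<bar> < \<epsilon>"
      by (rule cluster) (rule that)
    \<comment> \<open>Countably many sets, as pseudocompactness requires: \<open>S\<close> and all
      its possible finite truncations.\<close>
    let ?I = "insert S {s. finite s}"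
    have "\<exists>z\<in>topspace X. \<forall>s\<in>?I. g s z = c (b, s)" for b
    proof -
      have "countable ?I"
        by (simp add: countable_Collect_finite)
      then have "solves_systems X ?I" by (rule pseudocompact_solves_countable[OF pc])
      then obtain z where "z \<in> topspace X" "\<And>s. s \<in> ?I \<Longrightarrow> g s z = c (b, s)"
      proof (rule solves_systemsD[where g = g and c = "\<lambda>s. c (b, s)"])
        fix J and \<epsilon> :: real assume "finite J" "J \<subseteq> ?I" "\<epsilon> > 0"
        then obtain n where "\<forall>p\<in>{b} \<times> J. \<bar>(case p of (b, s) \<Rightarrow> g s (xb b n)) - c p\<bar> < \<epsilon>"
          using frequently_ex[OF c[of "{b} \<times> J" \<epsilon>]] by auto
        then show "\<exists>z\<in>topspace X. \<forall>s\<in>J. \<bar>g s z - c (b, s)\<bar> < \<epsilon>"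
          using xb by (intro bexI[of _ "xb b n"]) auto
      qed (use cont in auto)
      then show ?thesis by blast
    qed
    then obtain z where z: "\<And>b. z b \<in> topspace X" and zc: "\<And>b s. s \<in> ?I \<Longrightarrow> g s (z b) = c (b, s)"
      by metis
    have pair: "\<exists>n. P n \<and> \<bar>g s (x n) - c (True, s)\<bar> < \<epsilon> \<and> \<bar>g s (x' n) - c (False, s)\<bar> < \<epsilon>"
      if "eventually P sequentially" "\<epsilon> > 0" for P s \<epsilon>
    proof -
      have "\<exists>\<^sub>F n in sequentially. P n \<and>
          (\<forall>p\<in>{(True, s), (False, s)}. \<bar>(case p of (b, s) \<Rightarrow> g s (xb b n)) - c p\<bar> < \<epsilon>)"
        using that by (intro frequently_eventually_conj c) auto
      then show ?thesis using frequently_ex by (fastforce simp: xb_def)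
    qed
    have same: "c (True, s) = c (False, s)" if fin: "finite s" for s
    proof (rule ccontr)
      assume ne: "c (True, s) \<noteq> c (False, s)"
      define \<epsilon> where "\<epsilon> = \<bar>c (True, s) - c (False, s)\<bar> / 3"
      have "\<epsilon> > 0" using ne by (simp add: \<epsilon>_def)
      obtain k where "s \<subseteq> {..<k}" using fin unfolding finite_nat_iff_bounded by auto
      then have "\<forall>\<^sub>F n in sequentially. s \<subseteq> {..<n}"
        by (intro eventually_sequentiallyI[of k]) auto
      moreover have "\<forall>\<^sub>F n in sequentially. 1 / real (Suc n) < \<epsilon>"
        using order_tendstoD(2)[OF LIMSEQ_inverse_real_of_nat \<open>\<epsilon> > 0\<close>]
        by (simp add: inverse_eq_divide)
      ultimately have "\<forall>\<^sub>F n in sequentially. s \<subseteq> {..<n} \<and> 1 / real (Suc n) < \<epsilon>"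
        by (rule eventually_conj)
      from pair[OF this \<open>\<epsilon> > 0\<close>] obtain n where n: "s \<subseteq> {..<n}" "1 / real (Suc n) < \<epsilon>"
        "\<bar>g s (x n) - c (True, s)\<bar> < \<epsilon>" "\<bar>g s (x' n) - c (False, s)\<bar> < \<epsilon>" by blast
      have "\<bar>g s (x n) - g s (x' n)\<bar> \<le> 1 / real (Suc n)"
        using cl[of n] n(1) by (simp add: close_def)
      then have "\<bar>g s (x n) - g s (x' n)\<bar> < \<epsilon>" using n(2) by (rule le_less_trans)
      moreover have "\<bar>c (True, s) - c (False, s)\<bar> = 3 * \<epsilon>" by (simp add: \<epsilon>_def)
      ultimately show False using n(3,4) by linarith
    qed
    \<comment> \<open>The extra 1 in \<open>far\<close> absorbs the two approximation
      errors.\<close>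
    have "\<bar>c (True, S) - c (False, S)\<bar> > 2 * m"
    proof -
      obtain n where "\<bar>g S (x n) - c (True, S)\<bar> < 1 / 4" "\<bar>g S (x' n) - c (False, S)\<bar> < 1 / 4"
        using pair[of "\<lambda>_. True" "1 / 4" S] by auto
      then show ?thesis using far[of n] by linarith
    qed
    then have big: "\<bar>g S (z True) - g S (z False)\<bar> > 2 * m"
      by (simp add: zc)
    define N where "N = max (L (z True)) (L (z False))"
    define s where "s = S \<inter> {..<N}"
    have "\<bar>g S (z b) - g s (z b)\<bar> \<le> m" for b
    proof (rule L[OF z])
      have "L (z b) \<le> N" by (cases b) (auto simp: N_def)
      then show "S \<inter> {..<L (z b)} = s \<inter> {..<L (z b)}" unfolding s_def by auto
    qed
    from this[of True] this[of False] have "\<bar>g S (z True) - g S (z False)\<bar> \<le> 2 * m"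
      using same[of s] by (simp add: zc s_def)
    then show False using big by simp
  qed
  then have "(\<Union>n. E n) = UNIV" by auto
  then obtain n N S where dense: "\<And>T M. T \<inter> {..<N} = S \<inter> {..<N} \<Longrightarrow>
      \<exists>T'\<in>E n. T' \<inter> {..<M} = T \<inter> {..<M}"
    using Baire_cylinder by metis
  \<comment> \<open>\<open>E n\<close> is only dense in the cylinder, so \<open>T\<close> is
    replaced by a member of \<open>E n\<close> that agrees with it far enough for both points. This
    costs \<open>m\<close> at each point.\<close>
  have osc: "\<bar>g T x - g T x'\<bar> \<le> 4 * m + 1"
    if T: "T \<inter> {..<N} = S \<inter> {..<N}" and x: "x \<in> topspace X" "x' \<in> topspace X" "close n x x'"
    for T x x'
  proof -
    obtain T' where T': "T' \<in> E n" "T' \<inter> {..<max (L x) (L x')} = T \<inter> {..<max (L x) (L x')}"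
      using dense[OF T] by metis
    have "\<bar>g T' x - g T x\<bar> \<le> m" "\<bar>g T' x' - g T x'\<bar> \<le> m"
      by (rule L; use x Int_lessThan_mono[OF T'(2)] in simp)+
    moreover have "\<bar>g T' x - g T' x'\<bar> \<le> 2 * m + 1"
      using T'(1) x by (auto simp: E_def)
    ultimately show ?thesis by linarith
  qed
  obtain R where R: "finite R" "R \<subseteq> topspace X"
    "\<And>x. x \<in> topspace X \<Longrightarrow> \<exists>r\<in>R. close n x r"
    unfolding close_def
    by (rule finite_net[of "Pow {..<n}" "1 / real (Suc n)" "topspace X" g B, OF _ _ B]) (auto intro: that)
  \<comment> \<open>Finitely many \<open>r\<close> admit a common modulus. Going from
    \<open>x\<close> to \<open>r\<close> and back costs \<open>4 * m + 1\<close> each way, and the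
    change of set at \<open>r\<close> costs \<open>m\<close>.\<close>
  obtain N' where N': "\<And>r. r \<in> R \<Longrightarrow> L r \<le> N'"
    using R(1) finite_nat_set_iff_bounded_le[of "L ` R"] by auto
  show ?thesis
  proof (intro exI[of _ "max N N'"] exI[of _ S] allI impI ballI)
    fix T T' x
    assume T: "T \<inter> {..<max N N'} = S \<inter> {..<max N N'}" "T' \<inter> {..<max N N'} = S \<inter> {..<max N N'}"
      and x: "x \<in> topspace X"
    obtain r where r: "r \<in> R" "close n x r" using R(3)[OF x] by blast
    have rX: "r \<in> topspace X" using r(1) R(2) by auto
    have "T \<inter> {..<N} = S \<inter> {..<N}" "T' \<inter> {..<N} = S \<inter> {..<N}"
      using Int_lessThan_mono[OF T(1), of N] Int_lessThan_mono[OF T(2), of N] by simp_all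
    then have "\<bar>g T x - g T r\<bar> \<le> 4 * m + 1" "\<bar>g T' x - g T' r\<bar> \<le> 4 * m + 1"
      using osc x rX r(2) by auto
    moreover have "\<bar>g T r - g T' r\<bar> \<le> m"
    proof (rule L[OF rX])
      have "T \<inter> {..<max N N'} = T' \<inter> {..<max N N'}" using T by simp
      then show "T \<inter> {..<L r} = T' \<inter> {..<L r}"
        by (rule Int_lessThan_mono) (use N'[OF r(1)] in simp)
    qed
    ultimately show "\<bar>g T x - g T' x\<bar> \<le> 9 * m + 2" by linarith
  qed
qed

section \<open>Transfer of pseudocompactness\<close>

text \<open>The setting for one direction; it is instantiated a second time with the roles of the
  spaces and maps exchanged. One \<open>m\<close> serves both maps.\<close>

locale coarse_inverse =
  fixes X :: "'a topology" and Y :: "'b topology"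
    and \<phi> :: "('a \<Rightarrow> real) \<Rightarrow> ('b \<Rightarrow> real)" and \<psi> :: "('b \<Rightarrow> real) \<Rightarrow> ('a \<Rightarrow> real)"
    and m :: nat
  assumes psi_in: "f \<in> Cp_star Y \<Longrightarrow> \<psi> f \<in> Cp_star X"
    and phi_psi: "f \<in> Cp_star Y \<Longrightarrow> \<phi> (\<psi> f) = f"
    and phi_support: "y \<in> topspace Y \<Longrightarrow> \<exists>K. coarse_support X \<phi> m y K"
    and psi_support: "x \<in> topspace X \<Longrightarrow> \<exists>K. coarse_support Y \<psi> m x K"
begin

text \<open>The contrapositive of \<open>coarse_support_scale\<close> for \<open>\<psi> f\<close>
  and \<open>\<psi> g\<close>.\<close>

lemma separated_on_support:
  fixes L :: nat
  assumes "coarse_support X \<phi> m y K" and "f \<in> Cp_star Y" and "g \<in> Cp_star Y"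
    and "L > 0" and "\<bar>f y - g y\<bar> > real (m * L)"
  shows "\<exists>x\<in>K. \<bar>\<psi> f x - \<psi> g x\<bar> \<ge> real L"
proof (rule ccontr)
  assume "\<not> ?thesis"
  then have "\<bar>\<phi> (\<psi> f) y - \<phi> (\<psi> g) y\<bar> \<le> real (m * L)"
    using assms by (intro coarse_support_scale[of X \<phi> m y K] psi_in) (auto simp: not_le)
  then show False using assms by (simp add: phi_psi)
qed

lemma pseudocompact_transfer:
  assumes pc: "pseudocompact_space X"
  shows "pseudocompact_space Y"
proof (rule ccontr)
  assume "\<not> pseudocompact_space Y"
  then obtain u where u: "continuous_map Y euclideanreal u" and unb: "\<not> bounded (u ` topspace Y)"
    by (auto simp: pseudocompact_space_def)
  define w where "w y = \<bar>u y\<bar>" for y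
  have w: "continuous_map Y euclideanreal w"
    unfolding w_def by (intro continuous_intros u)
  have "\<exists>y\<in>topspace Y. w y > B" for B
    using unb unfolding bounded_iff by (force simp: w_def not_le)
  then obtain ys where ys: "\<And>k. ys k \<in> topspace Y" and gap: "\<And>k. w (ys (Suc k)) > w (ys k) + 1"
    using dependent_nat_choice[of "\<lambda>_ y. y \<in> topspace Y" "\<lambda>_ y y'. w y' > w y + 1"]
    by metis
  define v where "v k = w (ys k)" for k
  have v_diff: "v j + real (k - j) \<le> v k" if "j \<le> k" for j k
    using that
  proof (induction k rule: dec_induct)
    case (step k)
    then show ?case using gap[of k] by (simp add: v_def Suc_diff_le)
  qed simp
  have v0: "v k \<ge> 0" for k by (simp add: v_def w_def)
  have v_ge: "real k \<le> v k" for k using v_diff[of 0 k] v0[of 0] by simp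
  have v_apart: "\<bar>v j - v k\<bar> \<ge> 1" if "j \<noteq> k" for j k
    using that
  proof (induction j k rule: linorder_wlog)
    case (le j k)
    then have "real (k - j) \<ge> 1" by simp
    then show ?case using v_diff[OF le(1)] by linarith
  qed (simp add: abs_minus_commute)

  \<comment> \<open>Large enough to force a separation by \<open>9 * m + 3\<close>, one more than
    \<open>coarse_Namioka\<close> allows.\<close>
  define C where "C = real (m * (9 * m + 3)) + 1"
  have "C > 0" by (simp add: C_def add_nonneg_pos)
  \<comment> \<open>The point \<open>- 2\<close> keeps the set nonempty, since \<open>infdist t {} = 0\<close>.\<close>
  define A where "A S = insert (- 2) (v ` S)" for S
  \<comment> \<open>The supremum of tents of height \<open>C\<close> and radius 1 at the points of
    \<open>A S\<close>, continuous for infinite \<open>S\<close> too. The tent at \<open>- 2\<close>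
    vanishes on the values of \<open>w\<close>, which are nonnegative.\<close>
  define f where "f S = (\<lambda>y\<in>topspace Y. C * max 0 (1 - infdist (w y) (A S)))" for S
  have f_in: "f S \<in> Cp_star Y" for S
    unfolding f_def
  proof (rule restrict_in_Cp_star[where B = C])
    have "continuous_map euclideanreal euclideanreal (\<lambda>t. C * max 0 (1 - infdist t (A S)))"
      by (auto intro!: continuous_intros)
    from continuous_map_compose[OF w this]
    show "continuous_map Y euclideanreal (\<lambda>y. C * max 0 (1 - infdist (w y) (A S)))"
      by (simp add: o_def)
    show "\<bar>C * max 0 (1 - infdist (w y) (A S))\<bar> \<le> C" for y
      using \<open>C > 0\<close> infdist_nonneg[of "w y" "A S"] by (simp add: abs_mult)
  qed
  have infdist_ge: "r \<le> infdist t (A S)" if "\<And>a. a \<in> A S \<Longrightarrow> r \<le> dist t a" for r t S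
  proof -
    have "A S \<noteq> {}" by (simp add: A_def)
    then show ?thesis using that unfolding infdist_def by (auto intro!: cINF_greatest)
  qed
  have f_mem: "f S (ys k) = C" if "k \<in> S" for S k
  proof -
    have "w (ys k) \<in> A S" using that by (simp add: A_def v_def)
    then show ?thesis using ys by (simp add: f_def)
  qed
  have f_notmem: "f S (ys k) = 0" if "k \<notin> S" for S k
  proof -
    have "1 \<le> infdist (w (ys k)) (A S)"
    proof (rule infdist_ge)
      fix a assume "a \<in> A S"
      then consider "a = - 2" | j where "j \<in> S" "a = v j" by (auto simp: A_def)
      then show "1 \<le> dist (w (ys k)) a"
      proof cases
        case 1
        then show ?thesis by (simp add: w_def dist_real_def)
      next
        case 2
        then have "j \<noteq> k" using that by auto
        then show ?thesis using v_apart[of j k] 2 by (simp add: dist_real_def v_def)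
      qed
    qed
    then show ?thesis using ys by (simp add: f_def)
  qed
  \<comment> \<open>Since \<open>v k\<close> is at least \<open>k\<close>, tents with index at least
    \<open>N\<close> vanish where \<open>w y + 1\<close> is at most \<open>N\<close>.\<close>
  have f_eq: "f S y = f T y"
    if y: "y \<in> topspace Y" and ST: "S \<inter> {..<N} = T \<inter> {..<N}" and N: "w y + 1 \<le> real N"
    for S T y N
  proof -
    have *: "min 1 (infdist (w y) (A T)) \<le> infdist (w y) (A S)"
      if ST: "S \<inter> {..<N} = T \<inter> {..<N}" for S T
    proof (rule infdist_ge)
      fix a assume "a \<in> A S"
      then consider "a \<in> A T" | j where "j \<in> S" "j \<notin> T" "a = v j" by (auto simp: A_def)
      then show "min 1 (infdist (w y) (A T)) \<le> dist (w y) a"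
      proof cases
        case 1
        then show ?thesis by (meson infdist_le min.coboundedI2)
      next
        case 2
        have "N \<le> j"
        proof (rule ccontr)
          assume "\<not> N \<le> j"
          then have "j \<in> S \<inter> {..<N}" using 2(1) by simp
          then show False using 2(2) unfolding ST by simp
        qed
        then have "w y + 1 \<le> a" using N v_ge[of j] 2(3) by linarith
        then show ?thesis by (simp add: dist_real_def)
      qed
    qed
    show ?thesis
      using *[OF ST] *[OF ST[symmetric]] y by (auto simp: f_def)
  qed
  define g where "g S = \<psi> (f S)" for S
  have g_in: "g S \<in> Cp_star X" for S unfolding g_def by (intro psi_in f_in)
  have "\<exists>N S. \<forall>T T'. T \<inter> {..<N} = S \<inter> {..<N} \<longrightarrow> T' \<inter> {..<N} = S \<inter> {..<N} \<longrightarrow>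
      (\<forall>x\<in>topspace X. \<bar>g T x - g T' x\<bar> \<le> 9 * real m + 2)"
  proof (rule coarse_Namioka[OF pc])
    show "continuous_map X euclideanreal (g S)" for S
      using g_in by (rule Cp_star_continuous)
    fix x assume "x \<in> topspace X"
    then obtain K where K: "coarse_support Y \<psi> m x K" using psi_support by blast
    then have K': "finite K" "K \<subseteq> topspace Y" by (simp_all add: coarse_support_def)
    \<comment> \<open>The summands are positive, so the sum dominates each of them; it also makes
      sense for empty \<open>K\<close>.\<close>
    obtain N where N: "(\<Sum>p\<in>K. w p + 1) \<le> real N" using real_arch_simple by blast
    have N': "w p + 1 \<le> real N" if "p \<in> K" for p
      using member_le_sum[OF that, of "\<lambda>p. w p + 1"] K'(1) N by (auto simp: w_def)
    show "\<exists>N. \<forall>S T. S \<inter> {..<N} = T \<inter> {..<N} \<longrightarrow> \<bar>g S x - g T x\<bar> \<le> real m"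
    proof (intro exI[of _ N] allI impI)
      fix S T :: "nat set" assume ST: "S \<inter> {..<N} = T \<inter> {..<N}"
      have "f S p = f T p" if "p \<in> K" for p
        using f_eq[OF _ ST N'[OF that]] K'(2) that by auto
      then show "\<bar>g S x - g T x\<bar> \<le> real m"
        using K f_in by (auto simp: coarse_support_def g_def)
    qed
  qed
  then obtain N S where NS: "\<And>T T' x. T \<inter> {..<N} = S \<inter> {..<N} \<Longrightarrow> T' \<inter> {..<N} = S \<inter> {..<N} \<Longrightarrow>
      x \<in> topspace X \<Longrightarrow> \<bar>g T x - g T' x\<bar> \<le> 9 * real m + 2"
    by metis
  \<comment> \<open>Both \<open>insert N S\<close> and \<open>S - {N}\<close> agree with
    \<open>S\<close> below \<open>N\<close>, yet their functions differ by \<open>C\<close> at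
    \<open>ys N\<close>.\<close>
  obtain K where K: "coarse_support X \<phi> m (ys N) K" using phi_support ys by blast
  have "\<bar>f (insert N S) (ys N) - f (S - {N}) (ys N)\<bar> > real (m * (9 * m + 3))"
    by (simp add: f_mem f_notmem C_def)
  then obtain x where "x \<in> K" "\<bar>g (insert N S) x - g (S - {N}) x\<bar> \<ge> real (9 * m + 3)"
    using separated_on_support[OF K f_in f_in, of "9 * m + 3"] unfolding g_def by auto
  moreover have "x \<in> topspace X" using K \<open>x \<in> K\<close> by (auto simp: coarse_support_def)
  ultimately show False using NS[of "insert N S" "S - {N}" x] by auto
qed

section \<open>Transfer of solvability and of \<open>\<kappa>\<close>-pseudocompactness\<close>

text \<open>The index set on the side of \<open>X\<close> enumerates bumps at \<open>z\<close>: a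
  finite set \<open>S\<close> of coordinates and a steepness \<open>j\<close>.\<close>

lemma solves_systems_transfer:
  fixes A :: "'k set"
  assumes pcY: "pseudocompact_space Y"
    and solves: "solves_systems X ({S. finite S \<and> S \<subseteq> A} \<times> (UNIV :: nat set))"
  shows "solves_systems Y A"
  unfolding solves_systems_def
proof (intro allI impI)
  fix h and z :: "'k \<Rightarrow> real"
  assume h: "\<forall>i\<in>A. continuous_map Y euclideanreal (h i)"
    and approx: "\<forall>J \<epsilon>. finite J \<longrightarrow> J \<subseteq> A \<longrightarrow> \<epsilon> > 0 \<longrightarrow>
      (\<exists>y\<in>topspace Y. \<forall>i\<in>J. \<bar>h i y - z i\<bar> < \<epsilon>)"
  \<comment> \<open>Enumerating supports by \<open>{..<n}\<close>, with repetitions allowed, lets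
    the limit be taken for each position separately.\<close>
  define Yn where "Yn n = {y \<in> topspace Y. \<exists>k. coarse_support X \<phi> m y (k ` {..<n})}" for n :: nat
  define near where "near J \<epsilon> = {y. \<forall>i\<in>J. \<bar>h i y - z i\<bar> < \<epsilon>}" for J \<epsilon>
  have Yn: "\<exists>n. y \<in> Yn n" if y: "y \<in> topspace Y" for y
  proof -
    obtain K where K: "coarse_support X \<phi> m y K" using phi_support[OF y] by blast
    then have "finite K" by (simp add: coarse_support_def)
    then obtain n :: nat and k where "K = k ` {i. i < n}"
      using finite_imp_nat_seg_image_inj_on by blast
    then show ?thesis using K y by (auto simp: Yn_def lessThan_def)
  qed
  \<comment> \<open>Supports of bounded size are needed to pass to the limit of the supports.\<close>
  have "\<exists>n. \<forall>J \<epsilon>. finite J \<longrightarrow> J \<subseteq> A \<longrightarrow> \<epsilon> > 0 \<longrightarrow> Yn n \<inter> near J \<epsilon> \<noteq> {}"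
  proof (rule ccontr)
    assume "\<not> ?thesis"
    then have "\<forall>n. \<exists>J \<epsilon>. finite J \<and> J \<subseteq> A \<and> \<epsilon> > 0 \<and> Yn n \<inter> near J \<epsilon> = {}"
      by (simp only: not_ex not_all not_imp simp_thms)
    then obtain J \<epsilon> where J: "\<And>n. finite (J n)" "\<And>n. J n \<subseteq> A" "\<And>n. \<epsilon> n > 0"
      and disj: "\<And>n. Yn n \<inter> near (J n) (\<epsilon> n) = {}"
      by metis
    \<comment> \<open>The failures for all \<open>n\<close> involve only countably many coordinates,
      so pseudocompactness of \<open>Y\<close> gives an exact solution, which lies in some
      \<open>Yn n\<close>.\<close>
    have "countable (\<Union>n. J n)" using J(1) by (simp add: countable_finite)
    then have "solves_systems Y (\<Union>n. J n)" by (rule pseudocompact_solves_countable[OF pcY])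
    then obtain y where y: "y \<in> topspace Y" "\<And>i. i \<in> (\<Union>n. J n) \<Longrightarrow> h i y = z i"
    proof (rule solves_systemsD)
      show "continuous_map Y euclideanreal (h i)" if "i \<in> (\<Union>n. J n)" for i
        using h J(2) that by blast
      show "\<exists>y\<in>topspace Y. \<forall>i\<in>I. \<bar>h i y - z i\<bar> < \<delta>"
        if "finite I" "I \<subseteq> (\<Union>n. J n)" "\<delta> > 0" for I \<delta>
      proof -
        have "I \<subseteq> A" using that(2) J(2) by blast
        then show ?thesis using approx that by simp
      qed
    qed (rule that)
    obtain n where "y \<in> Yn n" using Yn y(1) by blast
    moreover have "y \<in> near (J n) (\<epsilon> n)"
    proof -
      have "h i y = z i" if "i \<in> J n" for i using that by (intro y(2)) blast
      then show ?thesis using J(3) by (simp add: near_def)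
    qed
    ultimately show False using disj by blast
  qed
  then obtain n where n: "\<And>J \<epsilon>. finite J \<Longrightarrow> J \<subseteq> A \<Longrightarrow> \<epsilon> > 0 \<Longrightarrow> Yn n \<inter> near J \<epsilon> \<noteq> {}"
    by metis
  have "\<forall>y\<in>Yn n. \<exists>k. coarse_support X \<phi> m y (k ` {..<n})" by (simp add: Yn_def)
  then obtain k where k: "\<And>y. y \<in> Yn n \<Longrightarrow> coarse_support X \<phi> m y (k y ` {..<n})"
    by metis
  have kX: "k y i \<in> topspace X" if "y \<in> Yn n" "i < n" for y i
    using k[OF that(1)] that(2) by (auto simp: coarse_support_def)

  \<comment> \<open>The filter of convergence to \<open>z\<close> in all coordinates of
    \<open>A\<close>, along \<open>Yn n\<close>.\<close>
  define F where "F = (INF q\<in>{(J, \<epsilon>). finite J \<and> J \<subseteq> A \<and> \<epsilon> > 0}. principal (Yn n \<inter> near (fst q) (snd q)))"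
  have evF: "eventually P F \<longleftrightarrow>
      (\<exists>J \<epsilon>. finite J \<and> J \<subseteq> A \<and> \<epsilon> > 0 \<and> (\<forall>y\<in>Yn n \<inter> near J \<epsilon>. P y))" for P
    unfolding F_def
  proof (subst eventually_INF_base)
    show "{(J, \<epsilon>). finite J \<and> J \<subseteq> A \<and> \<epsilon> > (0::real)} \<noteq> {}"
      using zero_less_one by blast
    fix a b :: "'k set \<times> real"
    assume ab: "a \<in> {(J, \<epsilon>). finite J \<and> J \<subseteq> A \<and> \<epsilon> > 0}" "b \<in> {(J, \<epsilon>). finite J \<and> J \<subseteq> A \<and> \<epsilon> > 0}"
    show "\<exists>x\<in>{(J, \<epsilon>). finite J \<and> J \<subseteq> A \<and> \<epsilon> > 0}.
        principal (Yn n \<inter> near (fst x) (snd x))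
        \<le> inf (principal (Yn n \<inter> near (fst a) (snd a))) (principal (Yn n \<inter> near (fst b) (snd b)))"
      using ab by (intro bexI[of _ "(fst a \<union> fst b, min (snd a) (snd b))"]) (auto simp: near_def)
  qed (auto simp: eventually_principal)
  have "F \<noteq> bot"
  proof
    assume "F = bot"
    then have "eventually (\<lambda>_. False) F" by simp
    then show False unfolding evF using n by blast
  qed
  have ev_near: "eventually (\<lambda>y. y \<in> Yn n \<inter> near J \<epsilon>) F" if "finite J" "J \<subseteq> A" "\<epsilon> > 0" for J \<epsilon>
    unfolding evF using that by blast
  have ev_Yn: "eventually (\<lambda>y. y \<in> Yn n) F"
    using ev_near[of "{}" 1] by (auto elim: eventually_mono)

  \<comment> \<open>Half the height of a bump still exceeds \<open>m * (m + 1)\<close> and so forces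
    a separation by \<open>m + 1\<close>.\<close>
  define C where "C = 2 * (real (m * (m + 1)) + 1)"
  have "C > 0" by (simp add: C_def add_nonneg_pos)
  define dev where "dev S y = (\<Sum>i\<in>S. \<bar>h i y - z i\<bar>)" for S y
  have dev_nonneg: "dev S y \<ge> 0" for S y by (simp add: dev_def sum_nonneg)
  define f where "f = (\<lambda>(S, j :: nat). \<lambda>y\<in>topspace Y. C * max 0 (1 - real j * dev S y))"
  define f0 where "f0 = (\<lambda>y\<in>topspace Y. 0 :: real)"
  let ?I = "{S. finite S \<and> S \<subseteq> A} \<times> (UNIV :: nat set)"
  have f_in: "f \<iota> \<in> Cp_star Y" if I: "\<iota> \<in> ?I" for \<iota>
  proof -
    obtain S j where \<iota>: "\<iota> = (S, j)" "finite S" "S \<subseteq> A" using I by auto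
    have "continuous_map Y euclideanreal (\<lambda>y. C * max 0 (1 - real j * dev S y))"
      unfolding dev_def using \<iota> h by (intro continuous_intros) auto
    moreover have "\<bar>C * max 0 (1 - real j * dev S y)\<bar> \<le> C" for y
      using \<open>C > 0\<close> dev_nonneg[of S y] by (simp add: abs_mult)
    ultimately show ?thesis
      unfolding f_def \<iota>(1) prod.case by (rule restrict_in_Cp_star)
  qed
  have f0_in: "f0 \<in> Cp_star Y"
    unfolding f0_def by (rule restrict_in_Cp_star[of _ _ 0]) auto
  \<comment> \<open>Differences are taken since \<open>\<psi>\<close> need not send the zero
    function to zero.\<close>
  define d where "d \<iota> x = \<psi> (f \<iota>) x - \<psi> f0 x" for \<iota> x
  have d_cont: "continuous_map X euclideanreal (d \<iota>)" if "\<iota> \<in> ?I" for \<iota>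
    unfolding d_def
    by (intro continuous_intros Cp_star_continuous[OF psi_in] f_in f0_in that)
  have "\<exists>D. \<forall>x\<in>topspace X. \<bar>d \<iota> x\<bar> \<le> D" if I: "\<iota> \<in> ?I" for \<iota>
  proof -
    obtain D1 D2 where "\<And>x. x \<in> topspace X \<Longrightarrow> \<bar>\<psi> (f \<iota>) x\<bar> \<le> D1"
        "\<And>x. x \<in> topspace X \<Longrightarrow> \<bar>\<psi> f0 x\<bar> \<le> D2"
      using psi_in[OF f_in[OF I]] psi_in[OF f0_in] unfolding Cp_star_iff by auto
    then have "\<bar>d \<iota> x\<bar> \<le> D1 + D2" if "x \<in> topspace X" for x
      using that unfolding d_def by fastforce
    then show ?thesis by blast
  qed
  then obtain D where D: "\<And>\<iota> x. \<iota> \<in> ?I \<Longrightarrow> x \<in> topspace X \<Longrightarrow> \<bar>d \<iota> x\<bar> \<le> D \<iota>"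
    by metis

  \<comment> \<open>The default 0 off the index set lets the bound required by
    \<open>cluster_values\<close> hold at all indices.\<close>
  define e where "e = (\<lambda>(i, \<iota>) y. if i < n \<and> \<iota> \<in> ?I then d \<iota> (k y i) else 0)"
  have "eventually (\<lambda>y. \<forall>p. \<bar>e p y\<bar> \<le> \<bar>D (snd p)\<bar>) F"
    using ev_Yn
  proof eventually_elim
    case (elim y)
    have "\<bar>e (i, \<iota>) y\<bar> \<le> \<bar>D \<iota>\<bar>" for i \<iota>
      using D[of \<iota> "k y i"] kX[OF elim, of i] by (auto simp: e_def)
    then show ?case by auto
  qed
  note cluster = cluster_values[OF \<open>F \<noteq> bot\<close> this]
  obtain c where c: "\<And>J \<epsilon>. finite J \<Longrightarrow> \<epsilon> > 0 \<Longrightarrow> \<exists>\<^sub>F y in F. \<forall>p\<in>J. \<bar>e p y - c p\<bar> < \<epsilon>"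
    by (rule cluster) (rule that)
  \<comment> \<open>The limit of the support points at position \<open>i\<close> need not lie in
    \<open>X\<close>, but solvability finds a point of \<open>X\<close> with the same values of all
    \<open>d \<iota>\<close>.\<close>
  have "\<exists>x\<in>topspace X. \<forall>\<iota>\<in>?I. d \<iota> x = c (i, \<iota>)" if "i < n" for i
  proof -
    obtain x where "x \<in> topspace X" "\<And>\<iota>. \<iota> \<in> ?I \<Longrightarrow> d \<iota> x = c (i, \<iota>)"
    proof (rule solves_systemsD[OF solves, where g = d and c = "\<lambda>\<iota>. c (i, \<iota>)"])
      fix J and \<epsilon> :: real assume J: "finite J" "J \<subseteq> ?I" "\<epsilon> > 0"
      have "\<exists>\<^sub>F y in F. y \<in> Yn n \<and> (\<forall>p\<in>{i} \<times> J. \<bar>e p y - c p\<bar> < \<epsilon>)"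
        using J by (intro frequently_eventually_conj c ev_Yn) auto
      then obtain y where y: "y \<in> Yn n" "\<forall>p\<in>{i} \<times> J. \<bar>e p y - c p\<bar> < \<epsilon>"
        using frequently_ex by blast
      have "\<bar>d \<iota> (k y i) - c (i, \<iota>)\<bar> < \<epsilon>" if "\<iota> \<in> J" for \<iota>
      proof -
        have "\<bar>e (i, \<iota>) y - c (i, \<iota>)\<bar> < \<epsilon>" using y(2) that by simp
        moreover have "\<iota> \<in> ?I" using J(2) that by (rule subsetD)
        ultimately show ?thesis using \<open>i < n\<close> by (simp add: e_def)
      qed
      then show "\<exists>x\<in>topspace X. \<forall>\<iota>\<in>J. \<bar>d \<iota> x - c (i, \<iota>)\<bar> < \<epsilon>"
        using kX[OF y(1) \<open>i < n\<close>] by blast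
    qed (use d_cont in auto)
    then show ?thesis by blast
  qed
  then obtain x where x: "\<And>i. i < n \<Longrightarrow> x i \<in> topspace X"
    and xc: "\<And>i \<iota>. i < n \<Longrightarrow> \<iota> \<in> ?I \<Longrightarrow> d \<iota> (x i) = c (i, \<iota>)"
    by metis
  have "\<forall>i<n. \<exists>P. coarse_support Y \<psi> m (x i) P" using psi_support x by simp
  then obtain P where P: "\<And>i. i < n \<Longrightarrow> coarse_support Y \<psi> m (x i) (P i)"
    by metis
  define Q where "Q = (\<Union>i<n. P i)"
  have Q: "finite Q" "Q \<subseteq> topspace Y"
    using P by (auto simp: Q_def coarse_support_def)
  have "\<exists>p\<in>Q. \<forall>i\<in>A. h i p = z i"
  proof (rule ccontr)
    assume "\<not> ?thesis"
    then have "\<forall>p\<in>Q. \<exists>i\<in>A. h i p \<noteq> z i" by blast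
    then obtain \<alpha> where \<alpha>: "\<And>p. p \<in> Q \<Longrightarrow> \<alpha> p \<in> A \<and> h (\<alpha> p) p \<noteq> z (\<alpha> p)"
      by metis
    \<comment> \<open>For every point of \<open>Q\<close>, \<open>S\<close> contains a coordinate at
      which the equation fails, so \<open>dev S\<close> is positive on \<open>Q\<close> and a steep
      enough bump vanishes there.\<close>
    define S where "S = \<alpha> ` Q"
    have S: "finite S" "S \<subseteq> A" using Q \<alpha> by (auto simp: S_def)
    have dev_pos: "dev S p > 0" if "p \<in> Q" for p
    proof -
      have "\<bar>h (\<alpha> p) p - z (\<alpha> p)\<bar> \<le> dev S p"
        unfolding dev_def using S(1) that by (intro member_le_sum) (auto simp: S_def)
      then show ?thesis using \<alpha>[OF that] by linarith
    qed
    obtain j where j: "(\<Sum>p\<in>Q. 1 / dev S p) \<le> real j" using real_arch_simple by blast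
    have f_Q: "f (S, j) p = 0" if "p \<in> Q" for p
    proof -
      have "1 / dev S p \<le> (\<Sum>p\<in>Q. 1 / dev S p)"
        using that Q(1) dev_nonneg by (intro member_le_sum) auto
      then have "1 / dev S p \<le> real j" using j by linarith
      then have "1 \<le> real j * dev S p" using dev_pos[OF that] by (simp add: field_simps)
      then show ?thesis using Q(2) that by (auto simp: f_def)
    qed
    have SI: "(S, j) \<in> ?I" using S by simp
    have c_le: "\<bar>c (i, (S, j))\<bar> \<le> m" if "i < n" for i
    proof -
      have "\<bar>f (S, j) p - f0 p\<bar> < 1" if "p \<in> P i" for p
      proof -
        have "p \<in> Q" using that \<open>i < n\<close> by (auto simp: Q_def)
        then show ?thesis using f_Q Q(2) by (auto simp: f0_def)
      qed
      then have "\<bar>d (S, j) (x i)\<bar> \<le> m"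
        using P[OF that] f_in[OF SI] f0_in by (simp add: coarse_support_def d_def)
      then show ?thesis using xc[OF that SI] by simp
    qed
    \<comment> \<open>Chosen so that \<open>j * dev S y\<close> is at most 1/2 on
      \<open>near S \<epsilon>\<close>; the added 1 avoids division by zero.\<close>
    define \<epsilon> where "\<epsilon> = 1 / (2 * (real j * real (card S) + 1))"
    have "\<epsilon> > 0" by (simp add: \<epsilon>_def add_nonneg_pos)
    have "\<exists>\<^sub>F y in F. y \<in> Yn n \<inter> near S \<epsilon> \<and> (\<forall>p\<in>{..<n} \<times> {(S, j)}. \<bar>e p y - c p\<bar> < 1)"
      using S \<open>\<epsilon> > 0\<close> by (intro frequently_eventually_conj c ev_near) auto
    then obtain y where y: "y \<in> Yn n" "y \<in> near S \<epsilon>" "\<forall>p\<in>{..<n} \<times> {(S, j)}. \<bar>e p y - c p\<bar> < 1"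
      using frequently_ex by blast
    have yY: "y \<in> topspace Y" using y(1) by (simp add: Yn_def)
    have "dev S y \<le> real (card S) * \<epsilon>"
      unfolding dev_def using y(2) by (intro sum_bounded_above) (auto simp: near_def less_imp_le)
    then have "real j * dev S y \<le> real j * (real (card S) * \<epsilon>)"
      by (rule mult_left_mono) simp
    also have "\<dots> \<le> 1 / 2"
    proof -
      have "r / (2 * (r + 1)) \<le> 1 / 2" if "r \<ge> 0" for r :: real
        using that by (simp add: field_simps)
      from this[of "real j * real (card S)"] show ?thesis by (simp add: \<epsilon>_def)
    qed
    finally have "1 - real j * dev S y \<ge> 1 / 2" by linarith
    then have "f (S, j) y \<ge> C * (1 / 2)"
      using yY \<open>C > 0\<close> by (simp add: f_def)
    then have "\<bar>f (S, j) y - f0 y\<bar> > real (m * (m + 1))"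
      using yY by (simp add: f0_def C_def)
    then obtain x' where "x' \<in> k y ` {..<n}" "\<bar>\<psi> (f (S, j)) x' - \<psi> f0 x'\<bar> \<ge> real (m + 1)"
      using separated_on_support[OF k[OF y(1)] f_in[OF SI] f0_in, of "m + 1"] by auto
    then obtain i where i: "i < n" "\<bar>d (S, j) (k y i)\<bar> \<ge> real m + 1"
      by (auto simp: d_def)
    \<comment> \<open>A value of size at least \<open>m + 1\<close> cannot be within less than 1 of
      a limit of size at most \<open>m\<close>.\<close>
    have "\<bar>e (i, (S, j)) y - c (i, (S, j))\<bar> < 1" using y(3) i(1) by simp
    then have "\<bar>d (S, j) (k y i) - c (i, (S, j))\<bar> < 1" using i(1) S by (simp add: e_def)
    then show False using i(2) c_le[OF i(1)] by linarith
  qed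
  then show "\<exists>y\<in>topspace Y. \<forall>i\<in>A. h i y = z i" using Q(2) by blast
qed

lemma kappa_pseudocompact_transfer:
  fixes \<kappa> :: "'k rel"
  assumes "Cinfinite \<kappa>" and "kappa_pseudocompact_space \<kappa> X"
  shows "kappa_pseudocompact_space \<kappa> Y"
proof (rule kappa_pseudocompactI)
  have "Field \<kappa> \<noteq> {}" using assms(1) by (auto simp: cinfinite_def)
  then have "pseudocompact_space X"
    using assms(2) by (rule kappa_pseudocompact_imp_pseudocompact[rotated])
  then show pcY: "pseudocompact_space Y" by (rule pseudocompact_transfer)
  show "solves_systems Y (Field \<kappa>)"
    by (rule solves_systems_transfer[OF pcY solves_systems_finite_subsets[OF assms(1)
          kappa_pseudocompact_solves_Field[OF assms(2)]]])
qed

end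

theorem corollary1p2:
  fixes X :: "'a topology" and Y :: "'b topology"
    and \<phi> :: "('a \<Rightarrow> real) \<Rightarrow> ('b \<Rightarrow> real)"
  assumes "tychonoff_space X" and "tychonoff_space Y"
    and "Cp_star_uniform_homeomorphism X Y \<phi>"
    and "Cp_star_bounded_map X Y \<phi>"
    and "Cp_star_bounded_map Y X (inv_into (Cp_star X) \<phi>)"
  shows "(pseudocompact_space X \<longleftrightarrow> pseudocompact_space Y) \<and>
    (\<forall>\<kappa> :: 'k rel. Cinfinite \<kappa> \<longrightarrow>
       (kappa_pseudocompact_space \<kappa> X \<longleftrightarrow> kappa_pseudocompact_space \<kappa> Y))"
proof -
  define \<psi> where "\<psi> = inv_into (Cp_star X) \<phi>"
  have bij: "bij_betw \<phi> (Cp_star X) (Cp_star Y)"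
    using assms(3) by (simp add: Cp_star_uniform_homeomorphism_def)
  obtain m1 where m1: "\<And>y. y \<in> topspace Y \<Longrightarrow> \<exists>K. coarse_support X \<phi> m1 y K"
    by (rule Cp_star_bounded_mapE[OF assms(4)]) (rule that)
  obtain m2 where m2: "\<And>x. x \<in> topspace X \<Longrightarrow> \<exists>K. coarse_support Y \<psi> m2 x K"
    by (rule Cp_star_bounded_mapE[OF assms(5)[folded \<psi>_def]]) (rule that)
  define m where "m = max m1 m2"
  have phi: "\<exists>K. coarse_support X \<phi> m y K" if "y \<in> topspace Y" for y
    using m1[OF that] coarse_support_mono[of X \<phi> m1 y _ m] by (auto simp: m_def)
  have psi: "\<exists>K. coarse_support Y \<psi> m x K" if "x \<in> topspace X" for x
    using m2[OF that] coarse_support_mono[of Y \<psi> m2 x _ m] by (auto simp: m_def)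
  interpret XY: coarse_inverse X Y \<phi> \<psi> m
    using phi psi bij_betwE[OF bij_betw_inv_into[OF bij]]
    by unfold_locales (simp_all add: \<psi>_def bij_betw_inv_into_right[OF bij])
  interpret YX: coarse_inverse Y X \<psi> \<phi> m
    using phi psi bij_betwE[OF bij]
    by unfold_locales (simp_all add: \<psi>_def bij_betw_inv_into_left[OF bij])
  show ?thesis
    using XY.pseudocompact_transfer YX.pseudocompact_transfer
      XY.kappa_pseudocompact_transfer YX.kappa_pseudocompact_transfer by blast
qed

end
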